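(* Let $(a_n)_{n\ge 1}$ be a sequence of distinct positive real numbers such that $\inf_{m\neq n}|a_m-a_n|\ge c$ for some constant $c>0$. Let $\epsilon>0$. For $N\ge 1$ let $A_N=\{a_1,\dots,a_N\}$ and $D_N=\#\{|a_m-a_n|:1\le m\ne n\le N\}$. Then for almost all $\alpha\in[0,1]$ there exists $N_0(\alpha)$ such that for all $N\ge N_0(\alpha)$: (a) $\delta^{\alpha}_{\min}(N)\ge \dfrac{1}{D_N\log N(\log_2 N)^{1+\epsilon}}$, and (b) $\delta^{\alpha}_{\min}(N)\le 1-\dfrac{1}{D_N\log N(\log_2 N)^{1+\epsilon}}$.
   Context: For $x\in\mathbb R$, $\|x\|=\min_{k\in\mathbb Z}|x-k|$. For a sequence $(a_n)$ and $\alpha\in\mathbb R$, $\delta^{\alpha}_{\min}(N)=\min\{\|\alpha(a_m-a_n)\|:1\le m\ne n\le N\}$. Throughout, $\log x$ denotes $\max(1,\log x)$ with $\log$ the natural logarithm, and $\log_2 x=\log(\log x)$ (iterated, with the same convention). "Almost all" refers to Lebesgue measure. *)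

theory Defs
  imports "HOL-Analysis.Analysis"
begin

text \<open>
  Distance to the nearest integer. The minimum over all integers is written as an infimum
  because \<open>Min\<close> is only meaningful for finite sets; it is attained, see below.
\<close>
definition dist_int :: "real \<Rightarrow> real" where
  "dist_int x = (INF k :: int. \<bar>x - of_int k\<bar>)"

lemma dist_int_le: "dist_int x \<le> \<bar>x - of_int k\<bar>"
  unfolding dist_int_def by (rule cINF_lower) (auto intro!: bdd_belowI2[where m = 0])

lemma dist_int_attained: "\<exists>k. dist_int x = \<bar>x - of_int k\<bar>"
proof
  have "\<bar>x - of_int (round x)\<bar> \<le> dist_int x"
    unfolding dist_int_def by (rule cINF_greatest) (auto simp: round_diff_minimal)
  with dist_int_le[of x "round x"] show "dist_int x = \<bar>x - of_int (round x)\<bar>"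
    by linarith
qed

text \<open>
  Sequences \<open>a :: nat \<Rightarrow> real\<close> are indexed from 1; the value \<open>a 0\<close> is never used.
  For \<open>N \<le> 1\<close> the minimum below is over the empty set and \<open>\<delta>\<^sub>m\<^sub>i\<^sub>n\<close> carries no information.
\<close>
definition delta_min :: "(nat \<Rightarrow> real) \<Rightarrow> real \<Rightarrow> nat \<Rightarrow> real" where
  "delta_min a \<alpha> N = Min {dist_int (\<alpha> * (a m - a n)) | m n. m \<in> {1..N} \<and> n \<in> {1..N} \<and> m \<noteq> n}"

definition num_diffs :: "(nat \<Rightarrow> real) \<Rightarrow> nat \<Rightarrow> nat" where
  "num_diffs a N = card {\<bar>a m - a n\<bar> | m n. m \<in> {1..N} \<and> n \<in> {1..N} \<and> m \<noteq> n}"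

text \<open>The truncated natural logarithm and its iterate (not the logarithm to base 2).\<close>
definition Log :: "real \<Rightarrow> real" where
  "Log x = max 1 (ln x)"

definition Log2 :: "real \<Rightarrow> real" where
  "Log2 x = Log (Log x)"

end

theory Submission
  imports Defs
begin

text \<open>
  Summability of \<open>f k = 1 / (k log k (log\<^sub>2 k)\<^sup>p)\<close> for \<open>p > 1\<close> is played against the growth of the
  difference sets \<open>S N\<close>. A difference that first appears at stage \<open>N\<close> is excluded at the level
  \<open>f (card (S N))\<close> fixed at that stage. Since \<open>f\<close> is decreasing, the sum of
  \<open>(card (S N) - card (S (N - 1))) f (card (S N))\<close> is at most the sum of \<open>f\<close>, whatever the jumps of
  \<open>card (S N)\<close>, and Borel-Cantelli applies. Running it with \<open>p = 1 + \<epsilon>/2\<close> leaves room for the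
  constants that arise from replacing \<open>log D\<^sub>N\<close> by \<open>log N\<close>, as \<open>D\<^sub>N \<le> N\<^sup>2\<close>.
\<close>

section \<open>Elementary estimates for truncated logarithms\<close>

lemma Log_ge_1: "1 \<le> Log x"
  and ln_le_Log: "ln x \<le> Log x"
  by (simp_all add: Log_def)

lemma Log2_ge_1: "1 \<le> Log2 x"
  by (simp add: Log2_def Log_ge_1)

lemma Log_mono: "0 < x \<Longrightarrow> x \<le> y \<Longrightarrow> Log x \<le> Log y"
  unfolding Log_def by (intro max.mono order.refl) simp

lemma Log2_mono: "0 < x \<Longrightarrow> x \<le> y \<Longrightarrow> Log2 x \<le> Log2 y"
  unfolding Log2_def using Log_ge_1[of x] by (intro Log_mono) auto

lemma Log_mult_le:
  assumes "1 \<le> x" "1 \<le> y"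
  shows "Log (x * y) \<le> ln x + Log y"
proof -
  have "ln (x * y) = ln x + ln y" using assms by (intro ln_mult_pos) auto
  then show ?thesis
    using ln_ge_zero[OF assms(1)] unfolding Log_def by linarith
qed

section \<open>Condensation and the summable levels\<close>

lemma Log_power2_ge: "real n / 2 \<le> Log (2 ^ n)"
proof -
  have "real n / 2 \<le> real n * ln 2"
    using ln2_ge_two_thirds mult_left_mono[of "1 / 2" "ln 2" "real n"] by simp
  also have "\<dots> = ln (2 ^ n)"
    by (simp add: ln_realpow)
  finally show ?thesis
    using ln_le_Log order_trans by blast
qed

text \<open>This is the series that dominates the condensed \<open>threshold\<close>. Condensing
  again cancels the factor \<open>real n\<close> and leaves
  \<open>2 / Log (2 ^ n / 2) powr p\<close>, which is of order \<open>n powr (-p)\<close>.\<close>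

lemma summable_inverse_Log:
  assumes "1 < p"
  shows "summable (\<lambda>n. 2 / (real n * Log (real n / 2) powr p))"
proof -
  have "summable (\<lambda>n. 2 ^ n * (2 / (real (2 ^ n) * Log (real (2 ^ n) / 2) powr p)))"
  proof (rule summable_comparison_test_ev)
    show "summable (\<lambda>n. 2 * 4 powr p * real n powr (-p))"
      using assms by (intro summable_mult) (simp add: summable_real_powr_iff)
    have "norm (2 ^ n * (2 / (real (2 ^ n) * Log (real (2 ^ n) / 2) powr p)))
        \<le> 2 * 4 powr p * real n powr (-p)" if n: "2 \<le> n" for n
    proof -
      obtain m where m: "n = Suc m" using n by (cases n) auto
      \<comment> \<open>With \<open>n = Suc m\<close> the argument is \<open>2 ^ m\<close>, and
        \<open>m / 2\<close> is at least \<open>n / 4\<close> once \<open>n\<close> is at least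
        2.\<close>
      have "real n / 4 \<le> Log (real (2 ^ n) / 2)"
        using Log_power2_ge[of m] n by (simp add: m)
      then have "(real n / 4) powr p \<le> Log (real (2 ^ n) / 2) powr p"
        using assms by (intro powr_mono2) auto
      moreover have "0 < (real n / 4) powr p" using n by simp
      ultimately have "2 / Log (real (2 ^ n) / 2) powr p \<le> 2 / (real n / 4) powr p"
        by (intro divide_left_mono mult_pos_pos) auto
      also have "\<dots> = 2 * 4 powr p * real n powr (-p)"
        by (simp add: powr_divide powr_minus field_simps)
      finally show ?thesis by simp
    qed
    then show "\<forall>\<^sub>F n in sequentially.
        norm (2 ^ n * (2 / (real (2 ^ n) * Log (real (2 ^ n) / 2) powr p)))
        \<le> 2 * 4 powr p * real n powr (-p)"
      by (auto simp: eventually_sequentially)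
  qed
  moreover have "2 / (real (Suc m) * Log (real (Suc m) / 2) powr p)
      \<le> 2 / (real m * Log (real m / 2) powr p)" if "0 < m" for m
  proof -
    have "Log (real m / 2) powr p \<le> Log (real (Suc m) / 2) powr p"
      using that assms Log_ge_1[of "real m / 2"] by (intro powr_mono2 Log_mono) auto
    moreover have "0 < Log (real m / 2) powr p"
      using Log_ge_1[of "real m / 2"] by simp
    ultimately show ?thesis
      using that by (intro divide_left_mono mult_mono mult_pos_pos) auto
  qed
  ultimately show ?thesis
    by (subst condensation_test) auto
qed

text \<open>Division by zero makes the value at \<open>k = 0\<close> equal to 0, so the function
  decreases only from 1 on. Hence the hypothesis \<open>0 < m\<close> wherever monotonicity is
  stated.\<close>

definition threshold :: "real \<Rightarrow> nat \<Rightarrow> real" where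
  "threshold p k = 1 / (real k * (Log (real k) * Log2 (real k) powr p))"

lemma weight_ge_1: "0 \<le> p \<Longrightarrow> 1 \<le> Log x * Log2 x powr p"
  using mult_mono[of 1 "Log x" 1 "Log2 x powr p"] Log_ge_1[of x]
    ge_one_powr_ge_zero[OF Log2_ge_1] by simp

lemma threshold_nonneg: "0 \<le> threshold p k"
  using Log_ge_1[of "real k"] by (simp add: threshold_def)

lemma threshold_antimono:
  assumes "0 \<le> p" "0 < m" "m \<le> n"
  shows "threshold p n \<le> threshold p m"
proof -
  have "Log (real m) * Log2 (real m) powr p \<le> Log (real n) * Log2 (real n) powr p"
    using assms Log_ge_1[of "real n"] Log2_ge_1[of "real m"]
    by (intro mult_mono powr_mono2 Log_mono Log2_mono) auto
  then have "real m * (Log (real m) * Log2 (real m) powr p)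
      \<le> real n * (Log (real n) * Log2 (real n) powr p)"
    by (rule mult_mono[rotated]) (use assms weight_ge_1[of p "real m"] in auto)
  moreover have "0 < real k * (Log (real k) * Log2 (real k) powr p)" if "0 < k" for k
    using that assms(1) weight_ge_1[of p "real k"] by (intro mult_pos_pos[of "real k"]) auto
  ultimately show ?thesis
    unfolding threshold_def using assms by (intro divide_left_mono[OF _ _ mult_pos_pos]) auto
qed

text \<open>The value at 1 is exactly 1. Levels up to 1 are those for which the centres listed in
  \<open>near_int\<close> suffice.\<close>

lemma threshold_le_1: "0 \<le> p \<Longrightarrow> threshold p k \<le> 1"
  using threshold_antimono[of p 1 k] by (cases "k = 0") (auto simp: threshold_def Log_def Log2_def)

text \<open>Condensation strips the factor \<open>real k\<close>; since \<open>Log (2 ^ n)\<close>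
  is at least \<open>n / 2\<close>, each iterated logarithm moves down one level and
  \<open>summable_inverse_Log\<close> takes over.\<close>

lemma summable_threshold:
  assumes "1 < p"
  shows "summable (threshold p)"
proof -
  have "summable (\<lambda>n. 2 ^ n * threshold p (2 ^ n))"
  proof (rule summable_comparison_test_ev)
    show "summable (\<lambda>n. 2 / (real n * Log (real n / 2) powr p))"
      by (rule summable_inverse_Log) fact
    have "norm (2 ^ n * threshold p (2 ^ n)) \<le> 2 / (real n * Log (real n / 2) powr p)"
      if n: "0 < n" for n
    proof -
      have "Log (real n / 2) powr p \<le> Log2 (2 ^ n) powr p"
        unfolding Log2_def using n assms Log_power2_ge[of n] Log_ge_1[of "real n / 2"]
        by (intro powr_mono2 Log_mono) auto
      then have "real n / 2 * Log (real n / 2) powr p \<le> Log (2 ^ n) * Log2 (2 ^ n) powr p"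
        using Log_power2_ge[of n] Log_ge_1[of "2 ^ n"] by (intro mult_mono) auto
      moreover have "0 < real n / 2 * Log (real n / 2) powr p"
        using n Log_ge_1[of "real n / 2"] by simp
      ultimately have "1 / (Log (2 ^ n) * Log2 (2 ^ n) powr p)
          \<le> 1 / (real n / 2 * Log (real n / 2) powr p)"
        by (intro frac_le) auto
      then show ?thesis
        using Log_ge_1[of "2 ^ n"] by (simp add: threshold_def abs_mult)
    qed
    then show "\<forall>\<^sub>F n in sequentially.
        norm (2 ^ n * threshold p (2 ^ n)) \<le> 2 / (real n * Log (real n / 2) powr p)"
      by (auto simp: eventually_sequentially intro!: exI[of _ 1])
  qed
  then show ?thesis
    using assms by (subst condensation_test) (auto intro: threshold_antimono threshold_nonneg)
qed

section \<open>Exceptional sets of a single difference\<close>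

text \<open>The centres \<open>k / d\<close> are the points where \<open>\<alpha> * d\<close> is an
  integer. The balls are not cut down to the unit interval; keeping them whole makes their lengths
  explicit.\<close>

definition near_int :: "real \<Rightarrow> real \<Rightarrow> real set" where
  "near_int d \<eta> = (\<Union>k\<le>nat \<lceil>d\<rceil>. ball (real k / d) (\<eta> / d))"

lemma near_int_borel: "near_int d \<eta> \<in> sets borel"
  unfolding near_int_def by measurable

lemma dist_int_ge_of_notin_near_int:
  assumes "0 < d" "\<eta> \<le> 1" "\<alpha> \<in> {0..1}" "\<alpha> \<notin> near_int d \<eta>"
  shows "\<eta> \<le> dist_int (\<alpha> * d)"
proof (rule ccontr)
  assume "\<not> ?thesis"
  moreover obtain k where k: "dist_int (\<alpha> * d) = \<bar>\<alpha> * d - of_int k\<bar>"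
    using dist_int_attained by blast
  ultimately have lt: "\<bar>\<alpha> * d - of_int k\<bar> < \<eta>" by simp
  have "0 \<le> \<alpha> * d" "\<alpha> * d \<le> d"
    using assms by (auto simp: mult_le_cancel_right1)
  \<comment> \<open>As \<open>\<alpha> * d\<close> lies between 0 and \<open>d\<close> and
    \<open>\<eta>\<close> is at most 1, the nearest integer falls in the index range of
    \<open>near_int\<close>.\<close>
  then have "-1 < real_of_int k" "real_of_int k < d + 1"
    using lt assms(2) by linarith+
  then have "0 \<le> k" "k \<le> \<lceil>d\<rceil>" by linarith+
  then obtain j where j: "k = int j" "j \<le> nat \<lceil>d\<rceil>"
    by (metis nat_0_le nat_mono)
  have "\<bar>real j / d - \<alpha>\<bar> = \<bar>\<alpha> * d - real j\<bar> / d"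
    using assms(1) by (simp add: abs_minus_commute abs_div_pos diff_divide_distrib)
  also have "\<dots> < \<eta> / d"
    using lt j assms(1) by (intro divide_strict_right_mono) auto
  finally have "\<alpha> \<in> near_int d \<eta>"
    using j unfolding near_int_def by (auto simp: dist_real_def)
  with assms(4) show False by simp
qed

text \<open>There are at most \<open>d + 2\<close> intervals, each of length
  \<open>2 * \<eta> / d\<close>. The gap \<open>c\<close> makes the resulting constant uniform in
  \<open>d\<close>.\<close>

lemma measure_near_int_le:
  assumes "0 < c" "c \<le> d" "0 \<le> \<eta>"
  shows "measure lborel (near_int d \<eta>) \<le> (2 + 4 / c) * \<eta>"
proof -
  have "measure lborel (near_int d \<eta>)
      \<le> (\<Sum>k\<le>nat \<lceil>d\<rceil>. measure lborel (ball (real k / d) (\<eta> / d)))"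
    unfolding near_int_def by (rule measure_UNION_le) auto
  also have "\<dots> = (real (nat \<lceil>d\<rceil>) + 1) * (2 * (\<eta> / d))"
    using assms by (simp add: ball_eq_greaterThanLessThan)
  also have "\<dots> \<le> (d + 2) * (2 * (\<eta> / d))"
  proof (rule mult_right_mono)
    show "real (nat \<lceil>d\<rceil>) + 1 \<le> d + 2" using assms by linarith
  qed (use assms in auto)
  also have "\<dots> = (2 + 4 / d) * \<eta>"
    using assms by (simp add: field_simps)
  also have "\<dots> \<le> (2 + 4 / c) * \<eta>"
    using assms by (intro mult_right_mono add_left_mono divide_left_mono) auto
  finally show ?thesis .
qed

lemma emeasure_near_int_finite: "emeasure lborel (near_int d \<eta>) < \<infinity>"
proof -
  have "bounded (near_int d \<eta>)"
    unfolding near_int_def by (intro bounded_UN) auto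
  then show ?thesis
    using emeasure_bounded_finite by auto
qed

text \<open>The exceptional \<open>\<alpha>\<close> are the countably many quotients
  \<open>k / d\<close>. This serves the finitely many differences that appear too early for
  Borel-Cantelli to control.\<close>

lemma AE_dist_int_pos:
  assumes "d \<noteq> 0"
  shows "AE \<alpha> in lborel. 0 < dist_int (\<alpha> * d)"
proof -
  have "\<alpha> \<in> (\<lambda>k. of_int k / d) ` UNIV" if "\<not> 0 < dist_int (\<alpha> * d)" for \<alpha>
  proof -
    obtain k where "dist_int (\<alpha> * d) = \<bar>\<alpha> * d - of_int k\<bar>"
      using dist_int_attained by blast
    with that have "\<alpha> = of_int k / d" using assms by (simp add: field_simps)
    then show ?thesis by blast
  qed
  moreover have "(\<lambda>k. real_of_int k / d) ` UNIV \<in> null_sets lborel"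
    by (intro countable_imp_null_set_lborel) auto
  ultimately show ?thesis
    by (intro AE_I'[of "(\<lambda>k. real_of_int k / d) ` UNIV"]) auto
qed

section \<open>Borel-Cantelli along a growing family of finite sets\<close>

text \<open>Each jump is charged to its own block \<open>{D i<..D (Suc i)}\<close>, on which
  \<open>f\<close> is smallest at the right end. Consecutive blocks are disjoint, so no value of
  \<open>f\<close> is used twice.\<close>

lemma sum_jumps_le:
  fixes f :: "nat \<Rightarrow> real"
  assumes "\<And>k. 0 \<le> f k" and "\<And>m n. 0 < m \<Longrightarrow> m \<le> n \<Longrightarrow> f n \<le> f m" and "incseq D"
  shows "(\<Sum>i<n. real (D (Suc i) - D i) * f (D (Suc i))) \<le> (\<Sum>k\<in>{D 0<..D n}. f k)"
proof (induction n)
  case (Suc n)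
  have le: "D 0 \<le> D n" "D n \<le> D (Suc n)"
    using assms(3) by (auto simp: incseq_def)
  have "real (D (Suc n) - D n) * f (D (Suc n)) = (\<Sum>k\<in>{D n<..D (Suc n)}. f (D (Suc n)))"
    by simp
  also have "\<dots> \<le> (\<Sum>k\<in>{D n<..D (Suc n)}. f k)"
    by (intro sum_mono assms(2)) auto
  finally have "(\<Sum>i<Suc n. real (D (Suc i) - D i) * f (D (Suc i)))
      \<le> (\<Sum>k\<in>{D 0<..D n}. f k) + (\<Sum>k\<in>{D n<..D (Suc n)}. f k)"
    using Suc by simp
  also have "\<dots> = (\<Sum>k\<in>{D 0<..D n} \<union> {D n<..D (Suc n)}. f k)"
    by (rule sum.union_disjoint[symmetric]) auto
  also have "{D 0<..D n} \<union> {D n<..D (Suc n)} = {D 0<..D (Suc n)}"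
    using le by auto
  finally show ?case .
qed simp

lemma summable_jumps:
  fixes f :: "nat \<Rightarrow> real"
  assumes "\<And>k. 0 \<le> f k" and "\<And>m n. 0 < m \<Longrightarrow> m \<le> n \<Longrightarrow> f n \<le> f m"
    and "incseq D" and "summable f"
  shows "summable (\<lambda>i. real (D (Suc i) - D i) * f (D (Suc i)))"
proof (rule summableI_nonneg_bounded)
  fix n
  have "(\<Sum>i<n. real (D (Suc i) - D i) * f (D (Suc i))) \<le> (\<Sum>k\<in>{D 0<..D n}. f k)"
    using assms(1-3) by (rule sum_jumps_le)
  also have "\<dots> \<le> suminf f"
    using assms by (intro sum_le_suminf) auto
  finally show "(\<Sum>i<n. real (D (Suc i) - D i) * f (D (Suc i))) \<le> suminf f" .
qed (use assms in simp)

text \<open>\<open>E N\<close> involves only the differences new at stage \<open>Suc N\<close>,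
  which makes its measure summable by \<open>summable_jumps\<close>. A late difference stays above
  the level of its first stage, and later levels are lower. The early ones are finitely many with
  positive distances, while the level tends to 0.\<close>

lemma AE_dist_int_ge_card:
  fixes f :: "nat \<Rightarrow> real" and S :: "nat \<Rightarrow> real set"
  assumes nonneg: "\<And>k. 0 \<le> f k" and le1: "\<And>k. f k \<le> 1"
    and anti: "\<And>m n. 0 < m \<Longrightarrow> m \<le> n \<Longrightarrow> f n \<le> f m" and sm: "summable f"
    and fin: "\<And>N. finite (S N)" and inc: "incseq S"
    and c: "0 < c" "\<And>N d. d \<in> S N \<Longrightarrow> c \<le> d"
    and top: "filterlim (\<lambda>N. card (S N)) at_top sequentially"
  shows "AE \<alpha> in lborel. \<alpha> \<in> {0..1} \<longrightarrow>
    (\<forall>\<^sub>F N in sequentially. \<forall>d\<in>S N. f (card (S N)) \<le> dist_int (\<alpha> * d))"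
proof -
  define D where "D N = card (S N)" for N
  define E where "E N = (\<Union>d\<in>S (Suc N) - S N. near_int d (f (D (Suc N))))" for N
  have incD: "incseq D"
    using inc fin unfolding D_def incseq_def by (meson card_mono)
  have sets_E: "E N \<in> sets lborel" for N
    unfolding E_def using fin by (auto intro!: sets.finite_UN near_int_borel)
  have "AE \<alpha> in lborel. \<forall>\<^sub>F N in sequentially. \<alpha> \<in> space lborel - E N"
  proof (rule borel_cantelli_AE1[OF sets_E])
    show "emeasure lborel (E N) < \<infinity>" for N
    proof -
      have "emeasure lborel (E N)
          \<le> (\<Sum>d\<in>S (Suc N) - S N. emeasure lborel (near_int d (f (D (Suc N)))))"
        unfolding E_def using fin by (intro emeasure_subadditive_finite) (auto simp: near_int_borel)
      also have "\<dots> < \<infinity>"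
        using fin emeasure_near_int_finite by auto
      finally show ?thesis .
    qed
    have bound: "measure lborel (E N)
        \<le> (2 + 4 / c) * (real (D (Suc N) - D N) * f (D (Suc N)))" for N
    proof -
      have "measure lborel (E N)
          \<le> (\<Sum>d\<in>S (Suc N) - S N. measure lborel (near_int d (f (D (Suc N)))))"
        unfolding E_def using fin by (intro measure_UNION_le) (auto simp: near_int_borel)
      also have "\<dots> \<le> (\<Sum>d\<in>S (Suc N) - S N. (2 + 4 / c) * f (D (Suc N)))"
        using c nonneg by (intro sum_mono measure_near_int_le) auto
      also have "card (S (Suc N) - S N) = D (Suc N) - D N"
        unfolding D_def using fin inc by (intro card_Diff_subset) (auto simp: incseq_Suc_iff)
      then have "(\<Sum>d\<in>S (Suc N) - S N. (2 + 4 / c) * f (D (Suc N)))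
          = (2 + 4 / c) * (real (D (Suc N) - D N) * f (D (Suc N)))"
        by simp
      finally show ?thesis .
    qed
    show "summable (\<lambda>N. measure lborel (E N))"
    proof (rule summable_comparison_test_ev)
      show "summable (\<lambda>N. (2 + 4 / c) * (real (D (Suc N) - D N) * f (D (Suc N))))"
        using nonneg anti incD sm by (intro summable_mult summable_jumps)
    qed (use bound in auto)
  qed
  moreover have "AE \<alpha> in lborel. \<forall>N. \<forall>d\<in>S N. 0 < dist_int (\<alpha> * d)"
    unfolding AE_all_countable
    using fin c by (fastforce intro!: AE_finite_allI AE_dist_int_pos)
  ultimately show ?thesis
  proof eventually_elim
    case (elim \<alpha>)
    show ?case
    proof
      assume \<alpha>: "\<alpha> \<in> {0..1}"
      obtain M where M: "\<alpha> \<notin> E N" if "M \<le> N" for N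
        using elim(1) by (auto simp: eventually_sequentially)
      \<comment> \<open>Borel-Cantelli says nothing about the differences already in
        \<open>S M\<close>; \<open>m\<close> bounds their distances from below. Inserting 1 keeps
        the minimum meaningful when \<open>S M\<close> is empty.\<close>
      define m where "m = Min (insert 1 ((\<lambda>d. dist_int (\<alpha> * d)) ` S M))"
      have "0 < m"
        unfolding m_def using fin elim(2) by (subst Min_gr_iff) auto
      have "(\<lambda>N. f (D N)) \<longlonglongrightarrow> 0"
        using summable_LIMSEQ_zero[OF sm] top unfolding D_def by (rule filterlim_compose)
      then have "\<forall>\<^sub>F N in sequentially. f (D N) < m"
        using \<open>0 < m\<close> by (rule order_tendstoD)
      then show "\<forall>\<^sub>F N in sequentially. \<forall>d\<in>S N. f (card (S N)) \<le> dist_int (\<alpha> * d)"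
      proof eventually_elim
        case (elim N)
        show ?case
        proof
          fix d assume d: "d \<in> S N"
          show "f (card (S N)) \<le> dist_int (\<alpha> * d)"
          proof (cases "d \<in> S M")
            case True
            then have "m \<le> dist_int (\<alpha> * d)"
              unfolding m_def using fin by (intro Min_le) auto
            with elim show ?thesis by (simp add: D_def)
          next
            case False
            \<comment> \<open>\<open>L\<close> is the stage of first appearance. It exceeds
              \<open>M\<close>, so it has a predecessor \<open>K\<close> with
              \<open>M \<le> K\<close>, and \<open>d\<close> is among the new differences that
              define \<open>E K\<close>.\<close>
            define L where "L = (LEAST i. d \<in> S i)"
            have L: "d \<in> S L" "L \<le> N"
              unfolding L_def using d by (auto intro: LeastI Least_le)
            have "M < L"
              using False L inc by (metis incseq_def linorder_not_less subsetD)
            then obtain K where K: "L = Suc K" "M \<le> K"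
              by (cases L) auto
            have "d \<notin> S K"
              using not_less_Least[of K "\<lambda>i. d \<in> S i"] K by (simp add: L_def)
            then have "\<alpha> \<notin> near_int d (f (D L))"
              using M[OF K(2)] L K unfolding E_def by auto
            then have "f (D L) \<le> dist_int (\<alpha> * d)"
              using c(1) c(2)[OF d] le1 \<alpha> by (intro dist_int_ge_of_notin_near_int) auto
            moreover have "0 < D L"
              unfolding D_def using L fin by (auto simp: card_gt_0_iff)
            then have "f (D N) \<le> f (D L)"
              using incD L by (intro anti) (auto simp: incseq_def)
            ultimately show ?thesis by (simp add: D_def)
          qed
        qed
      qed
    qed
  qed
qed

section \<open>Symmetry of the distance and the set of differences\<close>

lemma dist_int_uminus: "dist_int (- x) = dist_int x"
proof -
  have "dist_int (- x) \<le> dist_int x" for x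
  proof -
    obtain k where "dist_int x = \<bar>x - of_int k\<bar>"
      using dist_int_attained by blast
    then show ?thesis
      using dist_int_le[of "- x" "- k"] by simp
  qed
  from this[of x] this[of "- x"] show ?thesis by simp
qed

lemma dist_int_le_half: "dist_int x \<le> 1 / 2"
  using dist_int_le[of x "round x"] of_int_round_abs_le[of x] by (simp add: abs_minus_commute)

definition abs_diffs :: "(nat \<Rightarrow> real) \<Rightarrow> nat \<Rightarrow> real set" where
  "abs_diffs a N = {\<bar>a m - a n\<bar> | m n. m \<in> {1..N} \<and> n \<in> {1..N} \<and> m \<noteq> n}"

lemma abs_diffs_subset: "abs_diffs a N \<subseteq> (\<lambda>(m, n). \<bar>a m - a n\<bar>) ` ({1..N} \<times> {1..N})"
  unfolding abs_diffs_def by auto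

lemma finite_abs_diffs: "finite (abs_diffs a N)"
  using abs_diffs_subset by (rule finite_subset) auto

lemma card_abs_diffs_le: "card (abs_diffs a N) \<le> N\<^sup>2"
proof -
  have "card (abs_diffs a N) \<le> card ((\<lambda>(m, n). \<bar>a m - a n\<bar>) ` ({1..N} \<times> {1..N}))"
    by (intro card_mono abs_diffs_subset) auto
  also have "\<dots> \<le> card ({1..N} \<times> {1..N})"
    by (intro card_image_le) auto
  finally show ?thesis by (simp add: power2_eq_square)
qed

lemma incseq_abs_diffs: "incseq (abs_diffs a)"
  unfolding incseq_def abs_diffs_def by fastforce

text \<open>Already the differences with the smallest term are distinct.\<close>
lemma card_abs_diffs_ge:
  assumes "inj_on a {1..}"
  shows "N - 1 \<le> card (abs_diffs a N)"
proof (cases "N = 0")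
  case False
  have inj: "inj_on a {1..N}"
    using assms by (rule inj_on_subset) auto
  define \<mu> where "\<mu> = Min (a ` {1..N})"
  have "\<mu> \<in> a ` {1..N}"
    unfolding \<mu>_def using False by (intro Min_in) auto
  then obtain i where i: "i \<in> {1..N}" "a i = \<mu>" by auto
  have min: "a i \<le> a n" if "n \<in> {1..N}" for n
    using that by (simp add: i \<mu>_def)
  have "inj_on (\<lambda>n. \<bar>a n - a i\<bar>) ({1..N} - {i})"
  proof (rule inj_onI)
    fix m n assume mn: "m \<in> {1..N} - {i}" "n \<in> {1..N} - {i}" "\<bar>a m - a i\<bar> = \<bar>a n - a i\<bar>"
    then have "a m = a n" using min[of m] min[of n] by auto
    with inj mn show "m = n" by (auto dest: inj_onD)
  qed
  then have "card ((\<lambda>n. \<bar>a n - a i\<bar>) ` ({1..N} - {i})) = N - 1"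
    using i by (simp add: card_image)
  moreover have "card ((\<lambda>n. \<bar>a n - a i\<bar>) ` ({1..N} - {i})) \<le> card (abs_diffs a N)"
    using i(1) by (intro card_mono finite_abs_diffs) (unfold abs_diffs_def, blast)
  ultimately show ?thesis by simp
qed simp

lemma filterlim_card_abs_diffs:
  assumes "inj_on a {1..}"
  shows "filterlim (\<lambda>N. card (abs_diffs a N)) at_top sequentially"
proof (rule filterlim_at_top_mono)
  show "filterlim (\<lambda>N::nat. N - 1) at_top sequentially"
    by (rule filterlim_minus_const_nat_at_top)
qed (use card_abs_diffs_ge[OF assms] in simp)

text \<open>\<open>dist_int\<close> is even, so only the absolute differences matter, and these are
  what \<open>num_diffs\<close> counts.\<close>

lemma delta_min_eq: "delta_min a \<alpha> N = Min ((\<lambda>d. dist_int (\<alpha> * d)) ` abs_diffs a N)"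
proof -
  have "dist_int (\<alpha> * (a m - a n)) = dist_int (\<alpha> * \<bar>a m - a n\<bar>)" for m n
    using dist_int_uminus[of "\<alpha> * (a m - a n)"] by (simp add: abs_if flip: mult_minus_right)
  then show ?thesis
    unfolding delta_min_def abs_diffs_def by (intro arg_cong[where f = Min]) auto
qed

section \<open>Passing from the number of differences to \<open>N\<close>\<close>

lemma filterlim_Log2: "filterlim (\<lambda>N. Log2 (real N)) at_top sequentially"
proof (rule filterlim_at_top_mono)
  show "filterlim (\<lambda>N. ln (ln (real N))) at_top sequentially"
    by (intro filterlim_compose[OF ln_at_top] filterlim_real_sequentially)
  show "\<forall>\<^sub>F N in sequentially. ln (ln (real N)) \<le> Log2 (real N)"
    using eventually_ge_at_top[of 2]
  proof eventually_elim
    case (elim N)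
    have "ln (ln (real N)) \<le> ln (Log (real N))"
      using elim Log_ge_1[of "real N"] ln_le_Log[of "real N"] by simp
    then show ?case
      unfolding Log2_def using ln_le_Log[of "Log (real N)"] by linarith
  qed
qed

text \<open>For \<open>k\<close> up to \<open>N\<^sup>2\<close>, both \<open>Log\<close> and
  \<open>Log2\<close> at most double compared with their values at \<open>N\<close>. The bounded
  loss is absorbed by the surplus power \<open>Log2 N powr (q - p)\<close>, which is
  unbounded.\<close>

lemma eventually_weight_square_le:
  assumes "0 \<le> p" "p < q"
  shows "\<forall>\<^sub>F N in sequentially. \<forall>k\<in>{1..N\<^sup>2}.
    Log (real k) * Log2 (real k) powr p \<le> Log (real N) * Log2 (real N) powr q"
proof -
  have "filterlim (\<lambda>N. Log2 (real N) powr (q - p)) at_top sequentially"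
    using assms by (intro filterlim_compose[OF real_powr_at_top filterlim_Log2]) simp
  \<comment> \<open>One factor 2 comes from \<open>Log\<close>, the factor \<open>2 powr p\<close>
    from \<open>Log2\<close>.\<close>
  then have "\<forall>\<^sub>F N in sequentially. 2 * 2 powr p \<le> Log2 (real N) powr (q - p)"
    by (simp add: filterlim_at_top)
  then show ?thesis
  proof eventually_elim
    case (elim N)
    show ?case
    proof
      fix k assume k: "k \<in> {1..N\<^sup>2}"
      then have N: "1 \<le> N" by (cases N) auto
      define l where "l = Log2 (real N)"
      have l: "1 \<le> l" by (simp add: l_def Log2_ge_1)
      have kN: "real k \<le> (real N)\<^sup>2"
        using k by (metis atLeastAtMost_iff of_nat_le_iff of_nat_power)
      have "Log (real k) \<le> Log ((real N)\<^sup>2)"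
        using k kN by (intro Log_mono) auto
      also have "\<dots> \<le> ln (real N) + Log (real N)"
        using N Log_mult_le[of "real N" "real N"] by (simp add: power2_eq_square)
      also have "\<dots> \<le> 2 * Log (real N)"
        using ln_le_Log[of "real N"] by simp
      finally have 1: "Log (real k) \<le> 2 * Log (real N)" .
      then have "Log2 (real k) \<le> Log (2 * Log (real N))"
        unfolding Log2_def using Log_ge_1[of "real k"] by (intro Log_mono) auto
      also have "\<dots> \<le> ln 2 + l"
        unfolding l_def Log2_def by (intro Log_mult_le Log_ge_1) auto
      also have "\<dots> \<le> 2 * l"
        using l ln_2_less_1 by simp
      finally have "Log2 (real k) powr p \<le> (2 * l) powr p"
        using assms(1) Log2_ge_1[of "real k"] by (intro powr_mono2) auto
      then have "Log (real k) * Log2 (real k) powr p \<le> (2 * Log (real N)) * (2 * l) powr p"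
        using 1 Log_ge_1[of "real N"] by (intro mult_mono) auto
      also have "\<dots> = Log (real N) * ((2 * 2 powr p) * l powr p)"
        using l by (simp add: powr_mult)
      also have "\<dots> \<le> Log (real N) * (l powr (q - p) * l powr p)"
        using elim Log_ge_1[of "real N"] by (intro mult_left_mono mult_right_mono) (auto simp: l_def)
      also have "\<dots> = Log (real N) * l powr q"
        by (simp flip: powr_add)
      finally show "Log (real k) * Log2 (real k) powr p \<le> Log (real N) * Log2 (real N) powr q"
        by (simp add: l_def)
    qed
  qed
qed

theorem mainTheorem1:
  fixes a :: "nat \<Rightarrow> real" and c \<epsilon> :: real
  assumes "\<And>n. n \<ge> 1 \<Longrightarrow> a n > 0"
    and "inj_on a {1..}"
    and "c > 0"
    and "Inf {\<bar>a m - a n\<bar> | m n. m \<ge> 1 \<and> n \<ge> 1 \<and> m \<noteq> n} \<ge> c"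
    and "\<epsilon> > 0"
  shows "AE \<alpha> in lebesgue. \<alpha> \<in> {0..1} \<longrightarrow>
    (\<exists>N0 :: nat. \<forall>N \<ge> N0.
      delta_min a \<alpha> N
        \<ge> 1 / (real (num_diffs a N) * Log (real N) * Log2 (real N) powr (1 + \<epsilon>)) \<and>
      delta_min a \<alpha> N
        \<le> 1 - 1 / (real (num_diffs a N) * Log (real N) * Log2 (real N) powr (1 + \<epsilon>)))"
proof -
  define S where "S = abs_diffs a"
  define T where
    "T N = 1 / (real (num_diffs a N) * Log (real N) * Log2 (real N) powr (1 + \<epsilon>))" for N
  have S_ge: "c \<le> d" if "d \<in> S N" for d N
  proof -
    \<comment> \<open>On the reals \<open>Inf\<close> is a lower bound only of sets bounded below;
      here 0 is such a bound.\<close>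
    have "Inf {\<bar>a m - a n\<bar> | m n. m \<ge> 1 \<and> n \<ge> 1 \<and> m \<noteq> n} \<le> d"
      using that by (intro cInf_lower bdd_belowI[of _ 0]) (auto simp: S_def abs_diffs_def)
    with assms(4) show ?thesis by simp
  qed
  have num_diffs: "num_diffs a N = card (S N)" for N
    by (simp add: num_diffs_def S_def abs_diffs_def)
  have "AE \<alpha> in lborel. \<alpha> \<in> {0..1} \<longrightarrow>
      (\<forall>\<^sub>F N in sequentially. \<forall>d\<in>S N. threshold (1 + \<epsilon> / 2) (card (S N)) \<le> dist_int (\<alpha> * d))"
    using assms(2,3,5) S_ge unfolding S_def
    by (intro AE_dist_int_ge_card[where c = c] threshold_nonneg threshold_le_1 threshold_antimono
        summable_threshold finite_abs_diffs incseq_abs_diffs filterlim_card_abs_diffs) auto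
  then have "AE \<alpha> in lborel. \<alpha> \<in> {0..1} \<longrightarrow>
      (\<exists>N0. \<forall>N\<ge>N0. T N \<le> delta_min a \<alpha> N \<and> delta_min a \<alpha> N \<le> 1 - T N)"
  proof eventually_elim
    case (elim \<alpha>)
    show ?case
    proof
      assume "\<alpha> \<in> {0..1}"
      with elim have "\<forall>\<^sub>F N in sequentially.
          \<forall>d\<in>S N. threshold (1 + \<epsilon> / 2) (card (S N)) \<le> dist_int (\<alpha> * d)"
        by blast
      moreover have "\<forall>\<^sub>F N in sequentially. \<forall>k\<in>{1..N\<^sup>2}.
          Log (real k) * Log2 (real k) powr (1 + \<epsilon> / 2) \<le> Log (real N) * Log2 (real N) powr (1 + \<epsilon>)"
        using assms(5) by (intro eventually_weight_square_le) auto
      ultimately have "\<forall>\<^sub>F N in sequentially.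
          T N \<le> delta_min a \<alpha> N \<and> delta_min a \<alpha> N \<le> 1 - T N"
        using eventually_ge_at_top[of 3]
      proof eventually_elim
        case (elim N)
        define D where "D = card (S N)"
        \<comment> \<open>\<open>N \<ge> 3\<close> forces at least two differences, which later
          gives \<open>T N \<le> 1 / 2\<close>. The upper bound \<open>N\<^sup>2\<close> admits
          \<open>D\<close> as \<open>k\<close> in the weight comparison.\<close>
        have D: "2 \<le> D" "D \<in> {1..N\<^sup>2}"
          using card_abs_diffs_ge[OF assms(2), of N] card_abs_diffs_le[of a N] elim(3)
          by (auto simp: D_def S_def)
        then have ne: "S N \<noteq> {}" by (auto simp: D_def)
        have T: "T N = 1 / (real D * (Log (real N) * Log2 (real N) powr (1 + \<epsilon>)))"
          by (simp add: T_def num_diffs D_def mult.assoc)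
        have "T N \<le> threshold (1 + \<epsilon> / 2) D"
          unfolding T threshold_def
          using D elim(2)
            Log_ge_1[of "real D"] Log2_ge_1[of "real D"]
          by (intro frac_le mult_left_mono mult_pos_pos) auto
        then have ge: "T N \<le> delta_min a \<alpha> N"
          using elim(1) ne finite_abs_diffs[of a N] unfolding delta_min_eq S_def[symmetric]
          by (subst Min_ge_iff) (auto simp: D_def intro: order_trans)
        \<comment> \<open>For the upper bound (b) it suffices that \<open>T N\<close> and
          \<open>delta_min a \<alpha> N\<close> are both at most 1/2.\<close>
        have "2 * 1 \<le> real D * (Log (real N) * Log2 (real N) powr (1 + \<epsilon>))"
          using D assms(5) by (intro mult_mono weight_ge_1) auto
        then have "T N \<le> 1 / 2"
          unfolding T by (intro divide_left_mono) auto
        moreover have "delta_min a \<alpha> N \<le> 1 / 2"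
          using ne finite_abs_diffs[of a N] dist_int_le_half
          unfolding delta_min_eq S_def[symmetric] by (subst Min_le_iff) auto
        ultimately show ?case using ge by simp
      qed
      then show "\<exists>N0. \<forall>N\<ge>N0. T N \<le> delta_min a \<alpha> N \<and> delta_min a \<alpha> N \<le> 1 - T N"
        by (simp add: eventually_sequentially)
    qed
  qed
  then show ?thesis
    \<comment> \<open>\<open>lebesgue\<close> is the completion of \<open>lborel\<close>, so the
      almost-everywhere statement carries over.\<close>
    unfolding T_def by (rule AE_completion)
qed

end
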